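(* Consider a fully actuated robot with $n$ degrees of freedom and $b$ rigid bodies, i.e. with actuation matrix $B=I_{n\times n}$, and with actual inertial parameter vector $\Theta_a\in\mathbb{R}^{10b}$. Suppose that $\hat\Theta=\Theta^*$ is evaluated from the optimization problem $$\hat\Theta=\operatorname*{argmin}_{\Theta\in\mathbb{R}^{10b}}\|\mathrm{U}_C-\mathrm{Y}_C\Theta\|_2$$ with $p^*$ samples, where the $p^*$ samples are such that the resulting parameter estimate $\Theta^*$ satisfies $$\mathrm{Y}_C(q,\dot q,\ddot q)\,\Theta^*=\mathrm{Y}_C(q,\dot q,\ddot q)\,\Theta_a .$$ Let $\ddot q_{cmd}\in\mathbb{R}^n$ be a desired vector of joint accelerations. If the control law used is $$\mathrm{U}_{cmd}=\mathrm{Y}(q,\dot q,\ddot q_{cmd})\,\hat\Theta ,$$ then $\ddot q=\ddot q_{cmd}$.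
   Context: The robot has configuration $q\in\mathbb{Q}\subset\mathbb{R}^n$, velocity $\dot q$ and acceleration $\ddot q$. Its equations of motion are $D(q)\ddot q+C(q,\dot q)\dot q+G(q)=B\mathrm{U}$, where $D(q)\in\mathbb{R}^{n\times n}$ is the mass (inertia) matrix, $C(q,\dot q)\in\mathbb{R}^{n\times n}$ is the Coriolis-centrifugal matrix, $G(q)\in\mathbb{R}^n$ is the gravity vector, $\mathrm{U}$ is the vector of actuator torques, and $B$ maps actuator torques to joint torques. The distances between joint axes are assumed known. The left-hand side is linear in a vector of inertial parameters $\Theta\in\mathbb{R}^{10b}$ (10 per rigid body, the entries of that body's spatial inertia tensor about its joint axis), so that $D(q)\ddot q+C(q,\dot q)\dot q+G(q)=\mathrm{Y}(q,\dot q,\ddot q)\Theta$, where the matrix $\mathrm{Y}(q,\dot q,\ddot q)$ is called the regressor. The vector $\Theta_a$ is the actual set of parameters, so the actual dynamics have left-hand side $\mathrm{Y}(q,\dot q,\ddot q)\Theta_a$; $\hat\Theta$ denotes the assumed (estimated) set. The parameter set need not be unique, i.e. different parameter vectors can give the same dynamics. Given $s$ samples of torque, angle, velocity and acceleration data $(\mathrm{U}[k],q[k],\dot q[k],\ddot q[k])$, $k=1,\dots,s$, $\mathrm{U}_C$ is the vertical stack of the torque vectors $\mathrm{U}[1],\dots,\mathrm{U}[s]$ and $\mathrm{Y}_C$ (also written $\mathrm{Y}_C(q,\dot q,\ddot q)$) is the vertical stack of the regressor matrices $\mathrm{Y}(q[k],\dot q[k],\ddot q[k])$, $k=1,\dots,s$;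 in the claim $s=p^*$. A minimizer of the least-squares problem is given by $\mathrm{pinv}(\mathrm{Y}_C)\mathrm{U}_C$, with pinv the Moore-Penrose pseudoinverse. It is asserted that $p^*$ samples with the stated property can be obtained.
   Formalization: The equation Y_C Θ* = Y_C Θ_a is required for all configurations, velocities and accelerations, not only at the p* recorded samples; with the samples alone the claim fails (e.g. a pendulum sampled only at q = 0, where gravity is not identified). *)

theory Defs
  imports "HOL-Analysis.Analysis"
begin

text \<open>
  Ten inertial parameters for each rigid body, the bodies being indexed by the finite type
  \<open>'b\<close>; the parameter space has dimension \<open>10 * CARD('b)\<close>.
\<close>

type_synonym 'b params = "real ^ (10 \<times> 'b)"

text \<open>
  The inertia, Coriolis and gravity terms carry the inertial parameters as an explicit
  argument, since the regressor identity quantifies over all parameter vectors.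
\<close>

type_synonym ('n, 'b) mass_matrix = "'b params \<Rightarrow> real ^ 'n \<Rightarrow> real ^ 'n ^ 'n"
type_synonym ('n, 'b) coriolis_matrix =
  "'b params \<Rightarrow> real ^ 'n \<Rightarrow> real ^ 'n \<Rightarrow> real ^ 'n ^ 'n"
type_synonym ('n, 'b) gravity_vector = "'b params \<Rightarrow> real ^ 'n \<Rightarrow> real ^ 'n"
type_synonym ('n, 'b) regressor =
  "real ^ 'n \<Rightarrow> real ^ 'n \<Rightarrow> real ^ 'n \<Rightarrow> real ^ (10 \<times> 'b) ^ 'n"

definition dynamics_lhs ::
  "('n, 'b) mass_matrix \<Rightarrow> ('n, 'b) coriolis_matrix \<Rightarrow> ('n, 'b) gravity_vector \<Rightarrow>
   'b params \<Rightarrow> real ^ 'n \<Rightarrow> real ^ 'n \<Rightarrow> real ^ 'n \<Rightarrow> real ^ ('n::finite)"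
where
  "dynamics_lhs D C G \<Theta> q qd qdd = D \<Theta> q *v qdd + C \<Theta> q qd *v qd + G \<Theta> q"

definition is_regressor ::
  "(real ^ 'n) set \<Rightarrow> ('n, 'b) mass_matrix \<Rightarrow> ('n, 'b) coriolis_matrix \<Rightarrow>
   ('n, 'b) gravity_vector \<Rightarrow> ('n::finite, 'b::finite) regressor \<Rightarrow> bool"
where
  "is_regressor Q D C G Y \<longleftrightarrow>
     (\<forall>\<Theta>. \<forall>q\<in>Q. \<forall>qd qdd. dynamics_lhs D C G \<Theta> q qd qdd = Y q qd qdd *v \<Theta>)"

definition symmetric_pos_def :: "real ^ 'n ^ 'n \<Rightarrow> bool" where
  "symmetric_pos_def A \<longleftrightarrow> transpose A = A \<and> (\<forall>x. x \<noteq> 0 \<longrightarrow> x \<bullet> (A *v x) > 0)"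

text \<open>
  Vertical stacks over samples indexed by the finite type \<open>'p\<close>. The rows of a stack are
  indexed by pairs (sample, row within that sample).
\<close>

definition stack_vec :: "('p::finite \<Rightarrow> real ^ 'n::finite) \<Rightarrow> real ^ ('p \<times> 'n)" where
  "stack_vec u = (\<chi> r. u (fst r) $ snd r)"

definition stacked_regressor ::
  "('n::finite, 'b::finite) regressor \<Rightarrow> ('p::finite \<Rightarrow> real ^ 'n) \<Rightarrow> ('p \<Rightarrow> real ^ 'n) \<Rightarrow>
   ('p \<Rightarrow> real ^ 'n) \<Rightarrow> real ^ (10 \<times> 'b) ^ ('p \<times> 'n)"
where
  "stacked_regressor Y q qd qdd = (\<chi> r. Y (q (fst r)) (qd (fst r)) (qdd (fst r)) $ snd r)"

end

theory Submission
  imports Defs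
begin

text \<open>
  Matching on all stacked samples, applied to the sample that repeats one point, says that
  \<open>\<Theta>\<^sup>*\<close> and \<open>\<Theta>\<^sub>a\<close> give the same torques at that point. The commanded torque is therefore
  the actual dynamics at the commanded acceleration, and the acceleration is determined by the
  torque because the inertia matrix is injective.
\<close>

lemma stacked_regressor_mult_nth:
  "(stacked_regressor Y q qd qdd *v \<Theta>) $ (k, i) = (Y (q k) (qd k) (qdd k) *v \<Theta>) $ i"
  by (simp add: stacked_regressor_def matrix_vector_mult_def)

text \<open>If \<open>x\<close> and \<open>y\<close> differed, the quadratic form of
  \<open>A\<close> at \<open>x - y\<close> would be positive, yet \<open>A\<close> sends
  \<open>x - y\<close> to 0.\<close>

lemma symmetric_pos_def_mult_cancel:
  fixes A :: "real ^ 'n ^ 'n"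
  assumes "symmetric_pos_def A" and "A *v x = A *v y"
  shows "x = y"
proof (rule ccontr)
  assume "x \<noteq> y"
  then have "(x - y) \<bullet> (A *v (x - y)) > 0"
    using assms(1) by (simp add: symmetric_pos_def_def)
  then show False
    using assms(2) by (simp add: matrix_vector_mult_diff_distrib)
qed

text \<open>The Coriolis and gravity terms do not involve the acceleration, so they cancel and only
  the inertia term is left to compare.\<close>

lemma dynamics_lhs_acceleration_unique:
  assumes "symmetric_pos_def (D \<Theta> q)"
    and "dynamics_lhs D C G \<Theta> q qd a = dynamics_lhs D C G \<Theta> q qd a'"
  shows "a = a'"
  using assms by (auto simp: dynamics_lhs_def intro: symmetric_pos_def_mult_cancel)

theorem lemma1:
  fixes Q :: "(real ^ 'n) set"
    and D :: "('n::finite, 'b::finite) mass_matrix"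
    and C :: "('n, 'b) coriolis_matrix"
    and G :: "('n, 'b) gravity_vector"
    and Y :: "('n, 'b) regressor"
    and B :: "real ^ 'n ^ 'n"
    and \<Theta>\<^sub>a \<Theta>_star \<Theta>_hat :: "'b params"
    and U_s q_s qd_s qdd_s :: "'p::finite \<Rightarrow> real ^ 'n"
    and q qd qdd qdd_cmd U_cmd :: "real ^ 'n"
  assumes regressor: "is_regressor Q D C G Y"
    and mass_matrix: "\<And>q. q \<in> Q \<Longrightarrow> symmetric_pos_def (D \<Theta>\<^sub>a q)"
    and fully_actuated: "B = mat 1"
    and samples: "\<And>k. q_s k \<in> Q"
    and least_squares:
      "is_arg_min
         (\<lambda>\<Theta>. norm (stack_vec U_s - stacked_regressor Y q_s qd_s qdd_s *v \<Theta>))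
         (\<lambda>\<Theta>. True) \<Theta>_star"
    and estimate: "\<Theta>_hat = \<Theta>_star"
    and matching:
      "\<And>(x :: 'p \<Rightarrow> real ^ 'n) v a. (\<And>k. x k \<in> Q) \<Longrightarrow>
         stacked_regressor Y x v a *v \<Theta>_star = stacked_regressor Y x v a *v \<Theta>\<^sub>a"
    and state: "q \<in> Q"
    and control: "U_cmd = Y q qd qdd_cmd *v \<Theta>_hat"
    and actual_dynamics: "dynamics_lhs D C G \<Theta>\<^sub>a q qd qdd = B *v U_cmd"
  shows "qdd = qdd_cmd"
proof -
  have "Y q qd qdd_cmd *v \<Theta>_star = Y q qd qdd_cmd *v \<Theta>\<^sub>a"
  proof (rule vec_eq_iff [THEN iffD2], rule allI)
    fix i
    \<comment> \<open>\<open>matching\<close> restricts only the configurations to \<open>Q\<close>,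
      so \<open>qdd_cmd\<close> may serve as a sample acceleration. All blocks of this stack
      coincide, so any sample index gives the row \<open>i\<close>.\<close>
    show "(Y q qd qdd_cmd *v \<Theta>_star) $ i = (Y q qd qdd_cmd *v \<Theta>\<^sub>a) $ i"
      using matching [of "\<lambda>_. q" "\<lambda>_. qd" "\<lambda>_. qdd_cmd"] state
      by (metis stacked_regressor_mult_nth)
  qed
  \<comment> \<open>The regressor identity at \<open>\<Theta>\<^sub>a\<close> turns
    \<open>Y q qd qdd_cmd *v \<Theta>\<^sub>a\<close> back into dynamics.\<close>
  then have "dynamics_lhs D C G \<Theta>\<^sub>a q qd qdd = dynamics_lhs D C G \<Theta>\<^sub>a q qd qdd_cmd"
    using regressor state
    by (simp add: actual_dynamics control estimate fully_actuated is_regressor_def)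
  then show ?thesis
    by (rule dynamics_lhs_acceleration_unique [where D = D, OF mass_matrix [OF state]])
qed

end
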